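(* On a two-dimensional Cartesian grid, the only symmetric linear divergence discretization (of $\partial_xu+\partial_yv$) on $3\times3$ cells that allows for a non-zero stationarity-consistent diffusion is $$\frac{\{\{[u]_{i\pm1}\}\}_{j\pm\frac12}}{8\Delta x}+\frac{[\{\{v\}\}_{i\pm\frac12}]_{j\pm1}}{8\Delta y}.$$ A linear stationarity-consistent diffusion discretization associated to this divergence is $$\frac14c_1\left(\frac{\{\{[[u]]_{i\pm\frac12}\}\}_{j\pm\frac12}}{\Delta x}+\frac{[[v]_{i\pm1}]_{j\pm1}}{\Delta y}\right)+\frac14c_2\left(\frac{[[u]_{i\pm1}]_{j\pm1}}{\Delta x}+\frac{[[\{\{v\}\}_{i\pm\frac12}]]_{j\pm\frac12}}{\Delta y}\right)$$ with arbitrary parameters $c_1,c_2$.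
   Context: The grid is Cartesian with constant spacings $\Delta x,\Delta y$ and cells $(i,j)\in\mathbb Z^2$; $u,v$ are the two velocity components. Bracket notation (in the index $i$; analogously in $j$; brackets in different directions commute and may be nested): $[q]_{i\pm1}=q_{i+1}-q_{i-1}$, $[[q]]_{i\pm\frac12}=q_{i+1}-2q_i+q_{i-1}$, $\{\{q\}\}_{i\pm\frac12}=q_{i+1}+2q_i+q_{i-1}$. For example $[[q]_{i\pm1}]_{j\pm1}=q_{i+1,j+1}-q_{i-1,j+1}-q_{i+1,j-1}+q_{i-1,j-1}$. All finite difference formulae are linear and use only the $3\times3$ block of cells (Moore neighborhood) consisting of $(i,j)$ and its 8 neighbors. "Symmetric" means directionally unbiased: the formula does not prefer any of the directions $\pm x,\pm y$ (the part in $u$ is odd under reflection of $i$ and even under reflection of $j$, the part in $v$ is odd under reflection of $j$ and even under reflection of $i$, and the two parts are exchanged upon interchanging the roles of $(x,u)$ and $(y,v)$). A "diffusion" is a linear finite difference formula on the $3\times3$ cells in $u$ and $v$ that approximates second derivatives of $u$ and $v$ (up to a factor proportional to the grid spacing). A finite difference formula $\mathcal B$ that vanishes whenever another given finite difference formula $\mathcal A$ does is called stationarity-consistent with $\mathcal A$. Here this is understood via the Fourier transform: a linear formula $\sum_S(\alpha_Su_{I+S}+\beta_Sv_{I+S})$, $I=(i,j)$, corresponds to $\sum_S(\alpha_S\hat u+\beta_S\hat v)\,t_x^{S_1}t_y^{S_2}$ with $t_x=\exp(\mathrm ik_x\Delta x)$, $t_y=\exp(\mathrm ik_y\Delta y)$;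 $\mathcal B$ is stationarity-consistent with $\mathcal A$ if the expression of $\mathcal B$ equals that of $\mathcal A$ times some factor (depending on $t_x,t_y$ only), which need not itself be a Laurent polynomial. *)

theory Defs
  imports "HOL-Analysis.Analysis"
begin

type_synonym grid_fun = "int \<Rightarrow> int \<Rightarrow> real"

text \<open>
  The six bracket operations on grid functions: \<open>diff\<close> is $[q]_{i\pm 1}$,
  \<open>diff2\<close> is $[[q]]_{i\pm 1/2}$ and \<open>sum2\<close> is $\{\{q\}\}_{i\pm 1/2}$, with suffix
  \<open>_x\<close> for the index $i$ and \<open>_y\<close> for the index $j$.
\<close>

definition diff_x :: "grid_fun \<Rightarrow> grid_fun" where
  "diff_x q = (\<lambda>i j. q (i + 1) j - q (i - 1) j)"

definition diff_y :: "grid_fun \<Rightarrow> grid_fun" where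
  "diff_y q = (\<lambda>i j. q i (j + 1) - q i (j - 1))"

definition diff2_x :: "grid_fun \<Rightarrow> grid_fun" where
  "diff2_x q = (\<lambda>i j. q (i + 1) j - 2 * q i j + q (i - 1) j)"

definition diff2_y :: "grid_fun \<Rightarrow> grid_fun" where
  "diff2_y q = (\<lambda>i j. q i (j + 1) - 2 * q i j + q i (j - 1))"

definition sum2_x :: "grid_fun \<Rightarrow> grid_fun" where
  "sum2_x q = (\<lambda>i j. q (i + 1) j + 2 * q i j + q (i - 1) j)"

definition sum2_y :: "grid_fun \<Rightarrow> grid_fun" where
  "sum2_y q = (\<lambda>i j. q i (j + 1) + 2 * q i j + q i (j - 1))"

text \<open>
  A linear formula is given by its coefficients \<open>(\<alpha>, \<beta>)\<close> in front of \<open>u\<close> and \<open>v\<close>. Only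
  the coefficients at shifts in \<open>moore\<close> are ever used, so two coefficient pairs describe
  the same formula iff their \<open>fd_apply\<close> agree.
\<close>

type_synonym formula = "(int \<Rightarrow> int \<Rightarrow> real) \<times> (int \<Rightarrow> int \<Rightarrow> real)"

definition moore :: "(int \<times> int) set" where
  "moore = {-1..1} \<times> {-1..1}"

definition fd_apply :: "formula \<Rightarrow> grid_fun \<Rightarrow> grid_fun \<Rightarrow> grid_fun" where
  "fd_apply F u v = (\<lambda>i j. \<Sum>(s, r)\<in>moore. fst F s r * u (i + s) (j + r) + snd F s r * v (i + s) (j + r))"

definition nonzero_formula :: "formula \<Rightarrow> bool" where
  "nonzero_formula F \<longleftrightarrow> fd_apply F \<noteq> (\<lambda>u v i j. 0)"

text \<open>
  Interchanging \<open>(x, u)\<close> and \<open>(y, v)\<close> also interchanges the spacings: the coefficients are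
  grid-independent weights divided by \<open>\<Delta>x\<close> in the \<open>u\<close>-part and by \<open>\<Delta>y\<close> in the \<open>v\<close>-part,
  and the weights are exchanged.
\<close>

definition symmetric_formula :: "real \<Rightarrow> real \<Rightarrow> formula \<Rightarrow> bool" where
  "symmetric_formula \<Delta>x \<Delta>y F \<longleftrightarrow>
     (\<forall>(s, r)\<in>moore.
        fst F (- s) r = - fst F s r \<and> fst F s (- r) = fst F s r \<and>
        snd F s (- r) = - snd F s r \<and> snd F (- s) r = snd F s r \<and>
        \<Delta>x * fst F s r = \<Delta>y * snd F r s)"

definition pd_x :: "(real \<Rightarrow> real \<Rightarrow> real) \<Rightarrow> real \<Rightarrow> real \<Rightarrow> real" where
  "pd_x f = (\<lambda>x y. deriv (\<lambda>s. f s y) x)"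

definition pd_y :: "(real \<Rightarrow> real \<Rightarrow> real) \<Rightarrow> real \<Rightarrow> real \<Rightarrow> real" where
  "pd_y f = (\<lambda>x y. deriv (\<lambda>s. f x s) y)"

primrec C_k :: "nat \<Rightarrow> (real \<Rightarrow> real \<Rightarrow> real) \<Rightarrow> bool" where
  "C_k 0 f \<longleftrightarrow> continuous_on UNIV (\<lambda>(x, y). f x y)"
| "C_k (Suc n) f \<longleftrightarrow>
     (\<forall>x y. (\<lambda>s. f s y) differentiable (at x) \<and> (\<lambda>s. f x s) differentiable (at y)) \<and>
     C_k n (pd_x f) \<and> C_k n (pd_y f)"

definition smooth :: "(real \<Rightarrow> real \<Rightarrow> real) \<Rightarrow> bool" where
  "smooth f \<longleftrightarrow> (\<forall>n. C_k n f)"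

text \<open>
  The formula on the grid refined to spacings \<open>h * \<Delta>x\<close>, \<open>h * \<Delta>y\<close>, evaluated on point
  values of \<open>u\<close> and \<open>v\<close> around \<open>(x, y)\<close>. As the coefficients scale like an inverse
  length, they are divided by \<open>h\<close>.
\<close>

definition fd_refined ::
  "real \<Rightarrow> real \<Rightarrow> formula \<Rightarrow> (real \<Rightarrow> real \<Rightarrow> real) \<Rightarrow> (real \<Rightarrow> real \<Rightarrow> real) \<Rightarrow> real \<Rightarrow> real \<Rightarrow> real \<Rightarrow> real" where
  "fd_refined \<Delta>x \<Delta>y F u v x y h =
     (\<Sum>(s, r)\<in>moore.
        fst F s r / h * u (x + of_int s * (h * \<Delta>x)) (y + of_int r * (h * \<Delta>y)) +
        snd F s r / h * v (x + of_int s * (h * \<Delta>x)) (y + of_int r * (h * \<Delta>y)))"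

definition divergence_discretization :: "real \<Rightarrow> real \<Rightarrow> formula \<Rightarrow> bool" where
  "divergence_discretization \<Delta>x \<Delta>y F \<longleftrightarrow>
     (\<forall>u v x y. smooth u \<longrightarrow> smooth v \<longrightarrow>
        ((\<lambda>h. fd_refined \<Delta>x \<Delta>y F u v x y h) \<longlongrightarrow> pd_x u x y + pd_y v x y) (at_right 0))"

text \<open>
  A diffusion approximates a nontrivial linear combination of second derivatives, times the
  grid spacing (hence the extra division by \<open>h\<close>). The zero formula is counted as the
  trivial diffusion; formulae that only contain third or higher derivatives are no diffusions.
\<close>

definition diffusion :: "real \<Rightarrow> real \<Rightarrow> formula \<Rightarrow> bool" where
  "diffusion \<Delta>x \<Delta>y F \<longleftrightarrow>
     \<not> nonzero_formula F \<or>
     (\<exists>a1 a2 a3 b1 b2 b3. (a1, a2, a3, b1, b2, b3) \<noteq> (0, 0, 0, 0, 0, 0) \<and>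
       (\<forall>u v x y. smooth u \<longrightarrow> smooth v \<longrightarrow>
          ((\<lambda>h. fd_refined \<Delta>x \<Delta>y F u v x y h / h) \<longlongrightarrow>
             a1 * pd_x (pd_x u) x y + a2 * pd_x (pd_y u) x y + a3 * pd_y (pd_y u) x y +
             b1 * pd_x (pd_x v) x y + b2 * pd_x (pd_y v) x y + b3 * pd_y (pd_y v) x y)
          (at_right 0)))"

definition fourier_symbol :: "formula \<Rightarrow> complex \<Rightarrow> complex \<Rightarrow> complex \<Rightarrow> complex \<Rightarrow> complex" where
  "fourier_symbol F tx ty uh vh =
     (\<Sum>(s, r)\<in>moore. (of_real (fst F s r) * uh + of_real (snd F s r) * vh) * tx powi s * ty powi r)"

text \<open>
  The factor \<open>R\<close> may have poles, e.g. $(t_x - 1) / (t_x + 1)$. The identity of the two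
  expressions is therefore required for generic wave numbers, i.e. on an open dense set;
  by continuity this is equivalent to an identity of rational functions in $t_x, t_y$.
\<close>

definition stationarity_consistent :: "real \<Rightarrow> real \<Rightarrow> formula \<Rightarrow> formula \<Rightarrow> bool" where
  "stationarity_consistent \<Delta>x \<Delta>y B A \<longleftrightarrow>
     (\<exists>(R :: complex \<Rightarrow> complex \<Rightarrow> complex) (K :: (real \<times> real) set).
        open K \<and> closure K = UNIV \<and>
        (\<forall>(kx, ky)\<in>K. \<forall>uh vh.
           let tx = exp (\<i> * of_real (kx * \<Delta>x)); ty = exp (\<i> * of_real (ky * \<Delta>y))
           in fourier_symbol B tx ty uh vh = R tx ty * fourier_symbol A tx ty uh vh))"

definition allows_nonzero_diffusion :: "real \<Rightarrow> real \<Rightarrow> formula \<Rightarrow> bool" where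
  "allows_nonzero_diffusion \<Delta>x \<Delta>y A \<longleftrightarrow>
     (\<exists>B. diffusion \<Delta>x \<Delta>y B \<and> nonzero_formula B \<and> stationarity_consistent \<Delta>x \<Delta>y B A)"

definition the_divergence :: "real \<Rightarrow> real \<Rightarrow> grid_fun \<Rightarrow> grid_fun \<Rightarrow> grid_fun" where
  "the_divergence \<Delta>x \<Delta>y u v = (\<lambda>i j.
     sum2_y (diff_x u) i j / (8 * \<Delta>x) + diff_y (sum2_x v) i j / (8 * \<Delta>y))"

definition the_diffusion :: "real \<Rightarrow> real \<Rightarrow> real \<Rightarrow> real \<Rightarrow> grid_fun \<Rightarrow> grid_fun \<Rightarrow> grid_fun" where
  "the_diffusion \<Delta>x \<Delta>y c1 c2 u v = (\<lambda>i j.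
     1 / 4 * c1 * (sum2_y (diff2_x u) i j / \<Delta>x + diff_y (diff_x v) i j / \<Delta>y) +
     1 / 4 * c2 * (diff_y (diff_x u) i j / \<Delta>x + diff2_y (sum2_x v) i j / \<Delta>y))"

end

theory Submission imports Defs begin

text \<open>
  Write $z = t_x$, $w = t_y$. Symmetry forces the two symbols of a divergence, for \<open>u\<close> and for \<open>v\<close>, to be
  $(z - 1/z)(q + p(w + 1/w))$ and $\frac{\Delta x}{\Delta y}(w - 1/w)(q + p(z + 1/z))$, with only two
  weights $p, q$ left (lemma \<open>symmetric_formula_symbol\<close>). Consistency with $\partial_x u + \partial_y v$
  requires $2 \Delta x (q + 2p) = 1$, so what has to be shown is that a nonzero diffusion exists exactly for
  $q = 2p$.
  
  A formula $B$ that is stationarity-consistent with the divergence has the same quotient of its two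
  symbols. Multiplied crosswise, this is an identity of Laurent polynomials on the torus (lemma
  \<open>stationarity_consistent_cross\<close>). The point is whether $z - 1/z$ and $q + p(z + 1/z)$ have a common
  zero. A zero at $z = 1$ contradicts $q + 2p \neq 0$, and a zero at $z = -1$ means $q = 2p$. Without a common
  zero, the factor $z - 1/z$ divides the symbol of the \<open>u\<close>-part of $B$, and likewise $w - 1/w$ that of the
  \<open>v\<close>-part (lemma \<open>cross_identity_forces_odd\<close>). As all degrees are bounded by the size of the stencil, $B$ is
  then a multiple of the divergence itself. This is a first-order operator, and a diffusion has
  vanishing first moments, so $B = 0$ (lemma \<open>diffusion_forces_weights\<close>).
  
  For $q = 2p$ one has $q + p(z + 1/z) = p(z + 1)^2/z$, and the common factor $(z + 1)(w + 1)$ of the two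
  symbols can be replaced by combinations of $(z - 1)(w + 1)$ and $(z + 1)(w - 1)$. This gives precisely
  the two-parameter family of diffusions (lemma \<open>diffusion_formula_consistent\<close>). That it approximates
  second derivatives follows row by row from mean value theorems.
\<close>

section \<open>Coefficients and Fourier symbols\<close>

lemma sum_moore:
  fixes g :: "int \<Rightarrow> int \<Rightarrow> 'a::comm_monoid_add"
  shows "(\<Sum>(s, r)\<in>moore. g s r) =
    (g (-1) (-1) + g (-1) 0 + g (-1) 1) + (g 0 (-1) + g 0 0 + g 0 1) +
    (g 1 (-1) + g 1 0 + g 1 1)"
proof -
  have *: "{-1..1::int} = {-1, 0, 1}" by auto
  have "(\<Sum>(s, r)\<in>moore. g s r) = (\<Sum>s\<in>{-1, 0, 1}. \<Sum>r\<in>{-1, 0, 1}. g s r)"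
    unfolding moore_def * by (rule sum.cartesian_product [symmetric])
  then show ?thesis by (simp add: ac_simps)
qed

lemma moore_cases:
  assumes "(s, r) \<in> moore"
  shows "(s = -1 \<or> s = 0 \<or> s = 1) \<and> (r = -1 \<or> r = 0 \<or> r = 1)"
  using assms unfolding moore_def by auto

text \<open>
  Applying a formula to point masses recovers its coefficients.
\<close>

lemma fd_apply_eq_iff:
  "fd_apply F = fd_apply G \<longleftrightarrow>
    (\<forall>(s, r)\<in>moore. fst F s r = fst G s r \<and> snd F s r = snd G s r)"
proof
  have coeff: "fd_apply H (\<lambda>i j. if i = s \<and> j = r then 1 else 0) (\<lambda>i j. 0) 0 0 = fst H s r"
    "fd_apply H (\<lambda>i j. 0) (\<lambda>i j. if i = s \<and> j = r then 1 else 0) 0 0 = snd H s r"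
    if "(s, r) \<in> moore" for H s r
    using moore_cases[OF that] unfolding fd_apply_def sum_moore by auto
  assume "fd_apply F = fd_apply G"
  then show "\<forall>(s, r)\<in>moore. fst F s r = fst G s r \<and> snd F s r = snd G s r"
    by (auto simp flip: coeff)
next
  assume "\<forall>(s, r)\<in>moore. fst F s r = fst G s r \<and> snd F s r = snd G s r"
  then show "fd_apply F = fd_apply G"
    unfolding fd_apply_def by (intro ext sum.cong) auto
qed

lemma zero_formula_iff:
  "\<not> nonzero_formula F \<longleftrightarrow> (\<forall>(s, r)\<in>moore. fst F s r = 0 \<and> snd F s r = 0)"
proof -
  have "(\<lambda>u v i j. 0) = fd_apply (\<lambda>s r. 0, \<lambda>s r. 0)" unfolding fd_apply_def by auto
  then show ?thesis unfolding nonzero_formula_def by (simp add: fd_apply_eq_iff)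
qed

text \<open>
  The Fourier symbol of one of the two parts of a formula: a Laurent polynomial in \<open>tx\<close>, \<open>ty\<close>
  of degree at most one in each variable, in either sign.
\<close>

definition stencil_symbol :: "(int \<Rightarrow> int \<Rightarrow> real) \<Rightarrow> complex \<Rightarrow> complex \<Rightarrow> complex" where
  "stencil_symbol a tx ty = (\<Sum>(s, r)\<in>moore. of_real (a s r) * tx powi s * ty powi r)"

lemma fourier_symbol_stencil:
  "fourier_symbol F tx ty uh vh =
    stencil_symbol (fst F) tx ty * uh + stencil_symbol (snd F) tx ty * vh"
  unfolding fourier_symbol_def stencil_symbol_def sum_moore by (simp add: algebra_simps)

lemma stencil_symbol_expand:
  "stencil_symbol a tx ty =
    (of_real (a (-1) (-1)) / tx + of_real (a 0 (-1)) + of_real (a 1 (-1)) * tx) / ty +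
    (of_real (a (-1) 0) / tx + of_real (a 0 0) + of_real (a 1 0) * tx) +
    (of_real (a (-1) 1) / tx + of_real (a 0 1) + of_real (a 1 1) * tx) * ty"
  unfolding stencil_symbol_def sum_moore
  by (simp add: power_int_minus divide_inverse algebra_simps)

lemma stencil_symbol_transpose:
  "stencil_symbol (\<lambda>s r. a r s) tx ty = stencil_symbol a ty tx"
  unfolding stencil_symbol_expand by (simp add: algebra_simps add_divide_distrib)

lemma fourier_symbol_cong:
  assumes "fd_apply F = fd_apply G"
  shows "fourier_symbol F = fourier_symbol G"
  using assms unfolding fd_apply_eq_iff fourier_symbol_def by (intro ext sum.cong) auto

lemma stationarity_consistent_cong:
  assumes "fd_apply A = fd_apply A'"
  shows "stationarity_consistent \<Delta>x \<Delta>y B A \<longleftrightarrow> stationarity_consistent \<Delta>x \<Delta>y B A'"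
  unfolding stationarity_consistent_def fourier_symbol_cong[OF assms] ..

section \<open>Symbols on the torus\<close>

text \<open>
  This turns identities between symbols into identities between coefficients. The points \<open>1\<close> and
  \<open>-1\<close> are left out because the lemma is used after division by \<open>z - 1 / z\<close>.
\<close>

lemma laurent_zero_on_circle:
  fixes a b c :: complex
  assumes "\<And>z. norm z = 1 \<Longrightarrow> z \<noteq> 1 \<Longrightarrow> z \<noteq> -1 \<Longrightarrow> a / z + b + c * z = 0"
  shows "a = 0 \<and> b = 0 \<and> c = 0"
proof -
  have 1: "a / \<i> + b + c * \<i> = 0"
    by (rule assms) (auto simp: complex_eq_iff)
  have 2: "a / (-\<i>) + b + c * (-\<i>) = 0"
    by (rule assms) (auto simp: complex_eq_iff)
  \<comment> \<open>Three unknowns need three points; the third one is a rational point of the circle.\<close>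
  have "cmod (Complex (3/5) (4/5)) = 1"
    by (simp add: cmod_def power2_eq_square)
  then have 3: "a / Complex (3/5) (4/5) + b + c * Complex (3/5) (4/5) = 0"
    by (rule assms) (auto simp: complex_eq_iff)
  have "a / Complex (3/5) (4/5) = a * Complex (3/5) (-4/5)"
    by (simp add: complex_eq_iff Re_divide Im_divide power2_eq_square)
  with 3 have 3: "a * Complex (3/5) (-4/5) + b + c * Complex (3/5) (4/5) = 0" by simp
  have b: "b = 0" using 1 2 by (simp add: complex_eq_iff)
  have ac: "a = c" using 1 b by (simp add: complex_eq_iff)
  from 3 have "c = 0" unfolding ac b by (simp add: complex_eq_iff)
  with b ac show ?thesis by simp
qed

lemma unit_minus_inverse_nonzero:
  fixes w :: complex
  assumes "norm w = 1" "w \<noteq> 1" "w \<noteq> -1"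
  shows "w - 1 / w \<noteq> 0"
proof
  assume "w - 1 / w = 0"
  moreover have "w \<noteq> 0" using assms by auto
  ultimately have "w\<^sup>2 = 1" by (simp add: field_simps power2_eq_square)
  with assms show False by (simp add: power2_eq_1_iff)
qed

text \<open>
  Multiplying crosswise eliminates the unknown factor together with its poles. The resulting
  identity between Laurent polynomials is continuous, so it extends from a dense set of wave numbers
  to all of them, and these parametrize the whole torus.
\<close>

lemma stationarity_consistent_cross:
  assumes "stationarity_consistent \<Delta>x \<Delta>y B A" "\<Delta>x > 0" "\<Delta>y > 0"
    and "norm tx = 1" "norm ty = 1"
  shows "stencil_symbol (fst B) tx ty * stencil_symbol (snd A) tx ty =
         stencil_symbol (snd B) tx ty * stencil_symbol (fst A) tx ty"
proof -
  define e where "e = (\<lambda>d k. exp (\<i> * complex_of_real (k * d)))"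
  define g where "g = (\<lambda>(kx, ky).
     stencil_symbol (fst B) (e \<Delta>x kx) (e \<Delta>y ky) * stencil_symbol (snd A) (e \<Delta>x kx) (e \<Delta>y ky) -
     stencil_symbol (snd B) (e \<Delta>x kx) (e \<Delta>y ky) * stencil_symbol (fst A) (e \<Delta>x kx) (e \<Delta>y ky))"
  obtain R K where K: "closure K = (UNIV :: (real \<times> real) set)" and
    R: "\<And>kx ky uh vh. (kx, ky) \<in> K \<Longrightarrow> fourier_symbol B (e \<Delta>x kx) (e \<Delta>y ky) uh vh =
      R (e \<Delta>x kx) (e \<Delta>y ky) * fourier_symbol A (e \<Delta>x kx) (e \<Delta>y ky) uh vh"
    using assms(1) unfolding stationarity_consistent_def Let_def e_def by fastforce
  \<comment> \<open>The amplitudes \<open>(1, 0)\<close> and \<open>(0, 1)\<close> isolate the two stencils.\<close>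
  have "g k = 0" if "k \<in> K" for k
  proof -
    obtain kx ky where k: "k = (kx, ky)" by (cases k)
    show ?thesis
      using R[of kx ky 1 0] R[of kx ky 0 1] that unfolding k g_def
      by (simp add: fourier_symbol_stencil)
  qed
  moreover have "continuous_on (closure K) g"
    unfolding g_def e_def case_prod_unfold stencil_symbol_expand
    by (intro continuous_intros) auto
  ultimately have g0: "g k = 0" for k
    using continuous_constant_on_closure[of K g 0 k] K by auto
  obtain a b where "tx = exp (\<i> * complex_of_real a)" "ty = exp (\<i> * complex_of_real b)"
    using assms(4,5) complex_norm_eq_1_exp by metis
  with g0[of "(a / \<Delta>x, b / \<Delta>y)"] assms(2,3) show ?thesis
    unfolding g_def e_def by simp
qed

text \<open>
  The numbers \<open>q\<close> and \<open>p\<close> are the central and the lateral transversal weight of a symmetric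
  divergence. The conditions \<open>q \<noteq> 2 * p\<close> and \<open>q \<noteq> - 2 * p\<close> say that \<open>q + p * (z + 1 / z)\<close> has no zero at
  \<open>z = -1\<close> and \<open>z = 1\<close>, the zeros of \<open>z - 1 / z\<close>. So \<open>z - 1 / z\<close> has to divide the symbol of \<open>a\<close>, as it
  divides the right-hand side and is coprime to the other factors on the left; being of low degree in
  \<open>z\<close>, that symbol is then \<open>z - 1 / z\<close> times a function of \<open>w\<close>.
\<close>

lemma cross_identity_forces_odd:
  fixes p q :: real and \<kappa> \<mu> :: real
  assumes cross: "\<And>(z::complex) (w::complex). norm z = 1 \<Longrightarrow> norm w = 1 \<Longrightarrow>
      stencil_symbol a z w * (\<kappa> * (w - 1 / w) * (q + p * (z + 1 / z))) =
      stencil_symbol b z w * (\<mu> * (z - 1 / z) * (q + p * (w + 1 / w)))"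
    and "\<kappa> \<noteq> 0" "q \<noteq> 2 * p" "q \<noteq> - 2 * p" and r: "r \<in> {-1, 0, 1}"
  shows "a 0 r = 0 \<and> a (-1) r = - a 1 r"
proof -
  \<comment> \<open>At \<open>z = 1\<close> and \<open>z = -1\<close> the factor \<open>z - 1 / z\<close> removes the right-hand side.\<close>
  have vanish: "stencil_symbol a (of_real z) w = 0"
    if "z = 1 \<or> z = -1" "norm w = 1" "w \<noteq> 1" "w \<noteq> -1" for z :: real and w
  proof -
    have "complex_of_real (q + 2 * p * z) \<noteq> 0"
      using assms(3,4) that(1) unfolding of_real_eq_0_iff by auto
    then have "q + p * (of_real z + 1 / of_real z) \<noteq> (0 :: complex)"
      using that(1) by (auto simp: algebra_simps)
    moreover have "stencil_symbol a (of_real z) w *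
        (\<kappa> * (w - 1 / w) * (q + p * (of_real z + 1 / of_real z))) = 0"
      using cross[of "of_real z" w] that by auto
    ultimately show ?thesis using unit_minus_inverse_nonzero[of w] that(2-4) \<open>\<kappa> \<noteq> 0\<close> by auto
  qed
  have "of_real (a (-1) k + a 0 k + a 1 k) = (0 :: complex)" if "k \<in> {-1, 0, 1}" for k
    using laurent_zero_on_circle[of "of_real (a (-1) (-1) + a 0 (-1) + a 1 (-1))"
        "of_real (a (-1) 0 + a 0 0 + a 1 0)" "of_real (a (-1) 1 + a 0 1 + a 1 1)"]
      vanish[of 1] that unfolding stencil_symbol_expand by auto
  from this[OF r] have plus: "a (-1) r + a 0 r + a 1 r = 0" unfolding of_real_eq_0_iff .
  have "of_real (- a (-1) k + a 0 k - a 1 k) = (0 :: complex)" if "k \<in> {-1, 0, 1}" for k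
    using laurent_zero_on_circle[of "of_real (- a (-1) (-1) + a 0 (-1) - a 1 (-1))"
        "of_real (- a (-1) 0 + a 0 0 - a 1 0)" "of_real (- a (-1) 1 + a 0 1 - a 1 1)"]
      vanish[of "-1"] that unfolding stencil_symbol_expand by auto
  from this[OF r] have "- a (-1) r + a 0 r - a 1 r = 0" unfolding of_real_eq_0_iff .
  with plus show ?thesis by simp
qed

section \<open>Smooth functions\<close>

lemma smooth_pd:
  assumes "smooth f"
  shows "smooth (pd_x f)" "smooth (pd_y f)"
  using assms unfolding smooth_def by (metis C_k.simps(2))+

lemma smooth_derivs:
  assumes "smooth f"
  shows "((\<lambda>s. f s y) has_real_derivative pd_x f x y) (at x)"
    and "((\<lambda>s. f x s) has_real_derivative pd_y f x y) (at y)"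
proof -
  have "C_k (Suc 0) f" using assms unfolding smooth_def by blast
  then show "((\<lambda>s. f s y) has_real_derivative pd_x f x y) (at x)"
    "((\<lambda>s. f x s) has_real_derivative pd_y f x y) (at y)"
    by (auto simp: pd_x_def pd_y_def DERIV_deriv_iff_real_differentiable)
qed

lemma smooth_continuous:
  assumes "smooth f"
  shows "continuous_on UNIV (\<lambda>z. f (fst z) (snd z))"
proof -
  have "C_k 0 f" using assms unfolding smooth_def by blast
  then show ?thesis by (simp add: case_prod_unfold)
qed

lemma pd_flip: "pd_x (\<lambda>x y. f y x) = (\<lambda>x y. pd_y f y x)" "pd_y (\<lambda>x y. f y x) = (\<lambda>x y. pd_x f y x)"
  by (simp_all add: pd_x_def pd_y_def)

text \<open>
  All limits in the direction \<open>y\<close> are obtained from those in the direction \<open>x\<close> by this exchange.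
\<close>

lemma smooth_flip:
  assumes "smooth f"
  shows "smooth (\<lambda>x y. f y x)"
proof -
  have "C_k n (\<lambda>x y. f y x)" if "C_k n f" for n
    using that
  proof (induction n arbitrary: f)
    case 0
    then have "continuous_on UNIV (\<lambda>z. (\<lambda>(x, y). f x y) (prod.swap z))"
      by (intro continuous_on_compose2[OF _ continuous_on_swap]) auto
    then show ?case by (simp add: case_prod_unfold)
  next
    case (Suc n)
    then show ?case by (auto simp: pd_flip[of f])
  qed
  then show ?thesis using assms unfolding smooth_def by blast
qed

lemma pd_affine:
  "pd_x (\<lambda>x y. a + b * x + c * y) = (\<lambda>x y. b)" "pd_y (\<lambda>x y. a + b * x + c * y) = (\<lambda>x y. c)"
  unfolding pd_x_def pd_y_def by (auto intro!: ext DERIV_imp_deriv derivative_eq_intros)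

lemma smooth_affine: "smooth (\<lambda>x y. a + b * x + c * y)"
proof -
  have "C_k n (\<lambda>x y. a + b * x + c * y)" for n
  proof (induction n arbitrary: a b c)
    case 0
    show ?case by (auto simp: case_prod_unfold intro!: continuous_intros)
  next
    case (Suc n)
    have "pd_x (\<lambda>x y. a + b * x + c * y) = (\<lambda>x y. b + 0 * x + 0 * y)"
      "pd_y (\<lambda>x y. a + b * x + c * y) = (\<lambda>x y. c + 0 * x + 0 * y)"
      unfolding pd_affine by simp_all
    then show ?case
      by (simp only: C_k.simps Suc.IH) (auto intro!: derivative_intros)
  qed
  then show ?thesis unfolding smooth_def by blast
qed

section \<open>Limits of difference quotients\<close>

text \<open>
  Each difference quotient below equals a derivative at some point of the shrinking stencil, by a
  mean value theorem; continuity of that derivative in both variables jointly then gives the limit.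
\<close>

lemma tendsto_via_intermediate_point:
  assumes "smooth g"
    and "\<And>h. h > 0 \<Longrightarrow> \<exists>\<xi> \<eta>. \<bar>\<xi> - x\<bar> \<le> C * h \<and> \<bar>\<eta> - y\<bar> \<le> C * h \<and> E h = g \<xi> \<eta>"
  shows "(E \<longlongrightarrow> g x y) (at_right 0)"
proof -
  obtain \<xi> \<eta> where *: "\<And>h. h > 0 \<Longrightarrow> \<bar>\<xi> h - x\<bar> \<le> C * h \<and> \<bar>\<eta> h - y\<bar> \<le> C * h \<and> E h = g (\<xi> h) (\<eta> h)"
    using assms(2) by metis
  have pos: "\<forall>\<^sub>F h::real in at_right 0. h > 0" by (simp add: eventually_at_right_less)
  have "((\<lambda>h. C * h) \<longlongrightarrow> C * 0) (at_right 0)" by (intro tendsto_intros)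
  then have 0: "((\<lambda>h. C * h) \<longlongrightarrow> 0) (at_right 0)" by simp
  have "((\<lambda>h. \<xi> h - x) \<longlongrightarrow> 0) (at_right 0)" "((\<lambda>h. \<eta> h - y) \<longlongrightarrow> 0) (at_right 0)"
    by (rule Lim_null_comparison[OF _ 0], use pos in eventually_elim, use * in simp)+
  then have "(\<xi> \<longlongrightarrow> x) (at_right 0)" "(\<eta> \<longlongrightarrow> y) (at_right 0)"
    by (simp_all add: LIM_zero_iff)
  then have "((\<lambda>h. (\<xi> h, \<eta> h)) \<longlongrightarrow> (x, y)) (at_right 0)"
    by (rule tendsto_Pair)
  moreover have "isCont (\<lambda>z. g (fst z) (snd z)) (x, y)"
    using smooth_continuous[OF assms(1)] by (simp add: continuous_on_eq_continuous_at)
  ultimately have "((\<lambda>h. g (\<xi> h) (\<eta> h)) \<longlongrightarrow> g x y) (at_right 0)"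
    using isCont_tendsto_compose by fastforce
  then show ?thesis
    by (rule Lim_transform_eventually) (use pos in eventually_elim, use * in simp)
qed

lemma central_difference_mvt:
  fixes f f' :: "real \<Rightarrow> real"
  assumes "\<And>t. (f has_real_derivative f' t) (at t)" and "k > 0"
  shows "\<exists>\<xi>. \<bar>\<xi> - x\<bar> \<le> k \<and> f (x + k) - f (x - k) = 2 * k * f' \<xi>"
proof -
  obtain z where "x - k < z" "z < x + k" "f (x + k) - f (x - k) = (x + k - (x - k)) * f' z"
    using MVT2[of "x - k" "x + k" f f'] assms by auto
  then show ?thesis by (intro exI[of _ z]) auto
qed

text \<open>
  The even part of \<open>f\<close> around \<open>x\<close> is compared with a parabola through the same values at \<open>0\<close> and
  \<open>k\<close>. Rolle's theorem for the difference produces a central difference of \<open>f'\<close>, to which the first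
  order mean value theorem applies.
\<close>

lemma second_difference_mvt:
  fixes f f' f'' :: "real \<Rightarrow> real"
  assumes f': "\<And>t. (f has_real_derivative f' t) (at t)"
    and f'': "\<And>t. (f' has_real_derivative f'' t) (at t)" and "k > 0"
  shows "\<exists>\<xi>. \<bar>\<xi> - x\<bar> \<le> k \<and> f (x + k) - 2 * f x + f (x - k) = k\<^sup>2 * f'' \<xi>"
proof -
  \<comment> \<open>\<open>m\<close> is chosen such that \<open>G\<close> vanishes at \<open>0\<close> and at \<open>k\<close>, so that \<open>G'\<close> has a zero between.\<close>
  define F where "F t = f (x + t) + f (x - t)" for t
  define F1 where "F1 t = f' (x + t) - f' (x - t)" for t
  define m where "m = (F k - F 0) / k\<^sup>2"
  define G where "G t = F t - F 0 - t\<^sup>2 * m" for t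
  have dG: "(G has_real_derivative F1 t - 2 * t * m) (at t)" for t
  proof -
    have "((\<lambda>t. f (x + t)) has_real_derivative f' (x + t) * 1) (at t)"
      by (rule DERIV_chain2[OF f']) (auto intro!: derivative_eq_intros)
    moreover have "((\<lambda>t. f (x - t)) has_real_derivative f' (x - t) * (-1)) (at t)"
      by (rule DERIV_chain2[OF f']) (auto intro!: derivative_eq_intros)
    ultimately show ?thesis unfolding G_def F_def F1_def
      by (auto intro!: derivative_eq_intros)
  qed
  have "G 0 = 0" "G k = 0" using \<open>k > 0\<close> by (auto simp: G_def m_def)
  then obtain z where z: "0 < z" "z < k" "F1 z = 2 * z * m"
    using MVT2[of 0 k G, OF \<open>k > 0\<close> dG] \<open>k > 0\<close> by auto
  obtain \<xi> where \<xi>: "\<bar>\<xi> - x\<bar> \<le> z" "F1 z = 2 * z * f'' \<xi>"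
    using central_difference_mvt[OF f'' z(1), of x] unfolding F1_def by blast
  have "m = f'' \<xi>" using z \<xi> by simp
  then have "F k - F 0 = k\<^sup>2 * f'' \<xi>" using \<open>k > 0\<close> by (auto simp: m_def field_simps)
  then show ?thesis using z(2) \<xi>(1)
    by (intro exI[of _ \<xi>]) (auto simp: F_def)
qed

text \<open>
  The transversal shift \<open>h * c\<close> allows the rows of a stencil to be treated one by one.
\<close>

lemma central_difference_x_tendsto:
  assumes f: "smooth f" and "a > 0"
  shows "((\<lambda>h. (f (x + h * a) (y + h * c) - f (x - h * a) (y + h * c)) / (2 * (h * a)))
           \<longlongrightarrow> pd_x f x y) (at_right 0)"
proof (rule tendsto_via_intermediate_point[OF smooth_pd(1)[OF f], of _ "max a \<bar>c\<bar>"])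
  fix h :: real assume "h > 0"
  then have "h * a > 0" using \<open>a > 0\<close> by simp
  then obtain \<xi> where \<xi>: "\<bar>\<xi> - x\<bar> \<le> h * a"
    "f (x + h * a) (y + h * c) - f (x - h * a) (y + h * c) = 2 * (h * a) * pd_x f \<xi> (y + h * c)"
    using central_difference_mvt[of "\<lambda>s. f s (y + h * c)", OF smooth_derivs(1)[OF f]] by blast
  moreover have "h * a \<le> max a \<bar>c\<bar> * h" "\<bar>h * c\<bar> \<le> max a \<bar>c\<bar> * h"
    using \<open>h > 0\<close> by (simp_all add: abs_mult mult.commute)
  ultimately show "\<exists>\<xi> \<eta>. \<bar>\<xi> - x\<bar> \<le> max a \<bar>c\<bar> * h \<and> \<bar>\<eta> - y\<bar> \<le> max a \<bar>c\<bar> * h \<and>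
      (f (x + h * a) (y + h * c) - f (x - h * a) (y + h * c)) / (2 * (h * a)) = pd_x f \<xi> \<eta>"
    using \<open>h > 0\<close> \<open>a > 0\<close> by - (rule exI[of _ \<xi>], rule exI[of _ "y + h * c"], intro conjI order_trans[OF \<xi>(1)], simp_all)
qed

lemma second_difference_x_tendsto:
  assumes f: "smooth f" and "a > 0"
  shows "((\<lambda>h. (f (x + h * a) (y + h * c) - 2 * f x (y + h * c) + f (x - h * a) (y + h * c)) / (h * a)\<^sup>2)
           \<longlongrightarrow> pd_x (pd_x f) x y) (at_right 0)"
proof (rule tendsto_via_intermediate_point[OF smooth_pd(1)[OF smooth_pd(1)[OF f]], of _ "max a \<bar>c\<bar>"])
  fix h :: real assume "h > 0"
  then have "h * a > 0" using \<open>a > 0\<close> by simp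
  then obtain \<xi> where \<xi>: "\<bar>\<xi> - x\<bar> \<le> h * a"
    "f (x + h * a) (y + h * c) - 2 * f x (y + h * c) + f (x - h * a) (y + h * c) =
       (h * a)\<^sup>2 * pd_x (pd_x f) \<xi> (y + h * c)"
    using second_difference_mvt[of "\<lambda>s. f s (y + h * c)", OF smooth_derivs(1)[OF f]
        smooth_derivs(1)[OF smooth_pd(1)[OF f]]] by blast
  moreover have "h * a \<le> max a \<bar>c\<bar> * h" "\<bar>h * c\<bar> \<le> max a \<bar>c\<bar> * h"
    using \<open>h > 0\<close> by (simp_all add: abs_mult mult.commute)
  ultimately show "\<exists>\<xi> \<eta>. \<bar>\<xi> - x\<bar> \<le> max a \<bar>c\<bar> * h \<and> \<bar>\<eta> - y\<bar> \<le> max a \<bar>c\<bar> * h \<and>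
      (f (x + h * a) (y + h * c) - 2 * f x (y + h * c) + f (x - h * a) (y + h * c)) / (h * a)\<^sup>2 =
      pd_x (pd_x f) \<xi> \<eta>"
    using \<open>h > 0\<close> \<open>a > 0\<close> by - (rule exI[of _ \<xi>], rule exI[of _ "y + h * c"], intro conjI order_trans[OF \<xi>(1)], simp_all)
qed

text \<open>
  Applying the mean value theorem first in \<open>y\<close> and then in \<open>x\<close> yields the derivatives in the order
  \<open>pd_x (pd_y f)\<close>, the one in which a diffusion is stated.
\<close>

lemma mixed_difference_tendsto:
  assumes f: "smooth f" and "a > 0" "b > 0"
  shows "((\<lambda>h. (f (x + h * a) (y + h * b) - f (x - h * a) (y + h * b)
              - f (x + h * a) (y - h * b) + f (x - h * a) (y - h * b)) / (4 * (h * a) * (h * b)))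
           \<longlongrightarrow> pd_x (pd_y f) x y) (at_right 0)"
proof (rule tendsto_via_intermediate_point[OF smooth_pd(1)[OF smooth_pd(2)[OF f]], of _ "max a b"])
  fix h :: real assume "h > 0"
  then have k: "h * a > 0" "h * b > 0" using \<open>a > 0\<close> \<open>b > 0\<close> by auto
  \<comment> \<open>The outer difference is taken in \<open>y\<close>, which leaves an inner difference of \<open>pd_y f\<close>.\<close>
  have "((\<lambda>t. f (x + h * a) t - f (x - h * a) t) has_real_derivative
      pd_y f (x + h * a) t - pd_y f (x - h * a) t) (at t)" for t
    by (intro derivative_intros smooth_derivs f)
  from central_difference_mvt[OF this k(2), of y] obtain \<eta> where \<eta>: "\<bar>\<eta> - y\<bar> \<le> h * b"
    "f (x + h * a) (y + h * b) - f (x - h * a) (y + h * b) -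
      (f (x + h * a) (y - h * b) - f (x - h * a) (y - h * b)) =
     2 * (h * b) * (pd_y f (x + h * a) \<eta> - pd_y f (x - h * a) \<eta>)" by blast
  obtain \<xi> where \<xi>: "\<bar>\<xi> - x\<bar> \<le> h * a"
    "pd_y f (x + h * a) \<eta> - pd_y f (x - h * a) \<eta> = 2 * (h * a) * pd_x (pd_y f) \<xi> \<eta>"
    using central_difference_mvt[of "\<lambda>s. pd_y f s \<eta>", OF smooth_derivs(1)[OF smooth_pd(2)[OF f]] k(1)]
    by blast
  have "h * a \<le> max a b * h" "h * b \<le> max a b * h"
    using \<open>h > 0\<close> by (simp_all add: mult.commute)
  moreover have "f (x + h * a) (y + h * b) - f (x - h * a) (y + h * b)
              - f (x + h * a) (y - h * b) + f (x - h * a) (y - h * b) =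
        4 * (h * a) * (h * b) * pd_x (pd_y f) \<xi> \<eta>"
    using \<eta>(2) unfolding \<xi>(2) by (simp add: algebra_simps)
  ultimately show "\<exists>\<xi> \<eta>. \<bar>\<xi> - x\<bar> \<le> max a b * h \<and> \<bar>\<eta> - y\<bar> \<le> max a b * h \<and>
      (f (x + h * a) (y + h * b) - f (x - h * a) (y + h * b)
              - f (x + h * a) (y - h * b) + f (x - h * a) (y - h * b)) / (4 * (h * a) * (h * b)) =
      pd_x (pd_y f) \<xi> \<eta>"
    using \<open>h > 0\<close> \<open>a > 0\<close> \<open>b > 0\<close> by - (rule exI[of _ \<xi>], rule exI[of _ \<eta>], intro conjI order_trans[OF \<eta>(1)] order_trans[OF \<xi>(1)], simp_all)
qed

lemma central_difference_y_tendsto: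
  assumes "smooth f" and "b > 0"
  shows "((\<lambda>h. (f (x + h * c) (y + h * b) - f (x + h * c) (y - h * b)) / (2 * (h * b)))
           \<longlongrightarrow> pd_y f x y) (at_right 0)"
  using central_difference_x_tendsto[OF smooth_flip[OF assms(1)] assms(2)] by (simp add: pd_flip[of f])

lemma second_difference_y_tendsto:
  assumes f: "smooth f" and "b > 0"
  shows "((\<lambda>h. (f (x + h * c) (y + h * b) - 2 * f (x + h * c) y + f (x + h * c) (y - h * b)) / (h * b)\<^sup>2)
           \<longlongrightarrow> pd_y (pd_y f) x y) (at_right 0)"
  using second_difference_x_tendsto[OF smooth_flip[OF assms(1)] assms(2)]
  by (simp add: pd_flip[of f] pd_flip[of "pd_y f"])

section \<open>The distinguished divergence and its diffusions\<close>

text \<open>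
  The weights of the one-dimensional brackets $[q]$, $[[q]]$ and $\{\{q\}\}$ at a shift in \<open>{-1, 0, 1}\<close>.
  Nested brackets in different directions have products of these as weights.
\<close>

definition diff_w :: "int \<Rightarrow> real" where "diff_w s = of_int s"

definition diff2_w :: "int \<Rightarrow> real" where "diff2_w s = (if s = 0 then - 2 else 1)"

definition sum2_w :: "int \<Rightarrow> real" where "sum2_w s = (if s = 0 then 2 else 1)"

lemmas w_defs = diff_w_def diff2_w_def sum2_w_def

definition divergence_formula :: "real \<Rightarrow> real \<Rightarrow> formula" where
  "divergence_formula \<Delta>x \<Delta>y =
    (\<lambda>s r. diff_w s * sum2_w r / (8 * \<Delta>x), \<lambda>s r. sum2_w s * diff_w r / (8 * \<Delta>y))"

definition diffusion_formula :: "real \<Rightarrow> real \<Rightarrow> real \<Rightarrow> real \<Rightarrow> formula" where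
  "diffusion_formula \<Delta>x \<Delta>y c1 c2 =
    (\<lambda>s r. (c1 * (diff2_w s * sum2_w r) + c2 * (diff_w s * diff_w r)) / (4 * \<Delta>x),
     \<lambda>s r. (c1 * (diff_w s * diff_w r) + c2 * (sum2_w s * diff2_w r)) / (4 * \<Delta>y))"

lemma fd_apply_divergence_formula:
  "fd_apply (divergence_formula \<Delta>x \<Delta>y) = the_divergence \<Delta>x \<Delta>y"
  unfolding fd_apply_def sum_moore the_divergence_def divergence_formula_def
    sum2_y_def sum2_x_def diff_x_def diff_y_def w_defs
  by (intro ext) (simp add: add_divide_distrib diff_divide_distrib algebra_simps)

lemma fd_apply_diffusion_formula:
  "fd_apply (diffusion_formula \<Delta>x \<Delta>y c1 c2) = the_diffusion \<Delta>x \<Delta>y c1 c2"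
  unfolding fd_apply_def sum_moore the_diffusion_def diffusion_formula_def
    sum2_y_def sum2_x_def diff_x_def diff_y_def diff2_x_def diff2_y_def w_defs
  by (intro ext) (simp add: add_divide_distrib diff_divide_distrib algebra_simps)

lemma divergence_formula_discretizes:
  assumes "\<Delta>x > 0" "\<Delta>y > 0"
  shows "divergence_discretization \<Delta>x \<Delta>y (divergence_formula \<Delta>x \<Delta>y)"
  unfolding divergence_discretization_def
proof (intro allI impI)
  fix u v x y assume u: "smooth u" and v: "smooth v"
  define U where "U c h = (u (x + h * \<Delta>x) (y + h * c) - u (x - h * \<Delta>x) (y + h * c)) / (2 * (h * \<Delta>x))" for c h
  define V where "V c h = (v (x + h * c) (y + h * \<Delta>y) - v (x + h * c) (y - h * \<Delta>y)) / (2 * (h * \<Delta>y))" for c h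
  have "((\<lambda>h. (U \<Delta>y h + 2 * U 0 h + U (- \<Delta>y) h) / 4 + (V \<Delta>x h + 2 * V 0 h + V (- \<Delta>x) h) / 4) \<longlongrightarrow>
      (pd_x u x y + 2 * pd_x u x y + pd_x u x y) / 4 + (pd_y v x y + 2 * pd_y v x y + pd_y v x y) / 4)
      (at_right 0)"
    unfolding U_def V_def
    by (intro tendsto_intros central_difference_x_tendsto central_difference_y_tendsto u v assms) auto
  then show "((\<lambda>h. fd_refined \<Delta>x \<Delta>y (divergence_formula \<Delta>x \<Delta>y) u v x y h) \<longlongrightarrow>
      pd_x u x y + pd_y v x y) (at_right 0)"
    unfolding fd_refined_def sum_moore divergence_formula_def w_defs U_def V_def
    by (simp add: add_divide_distrib diff_divide_distrib algebra_simps)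
qed

text \<open>
  A transversal $\{\{\cdot\}\}$ averages three rows with weights adding up to \<open>4\<close>, and rows at shifts
  \<open>- h * c\<close>, \<open>0\<close>, \<open>h * c\<close> have the same limit.
\<close>

lemma diffusion_formula_tendsto:
  assumes pos: "\<Delta>x > 0" "\<Delta>y > 0" and u: "smooth u" and v: "smooth v"
  shows "((\<lambda>h. fd_refined \<Delta>x \<Delta>y (diffusion_formula \<Delta>x \<Delta>y c1 c2) u v x y h / h) \<longlongrightarrow>
      c1 * \<Delta>x * pd_x (pd_x u) x y + c2 * \<Delta>y * pd_x (pd_y u) x y +
      c1 * \<Delta>x * pd_x (pd_y v) x y + c2 * \<Delta>y * pd_y (pd_y v) x y) (at_right 0)"
proof -
  define U where "U c h = (u (x + h * \<Delta>x) (y + h * c) - 2 * u x (y + h * c) + u (x - h * \<Delta>x) (y + h * c)) / (h * \<Delta>x)\<^sup>2" for c h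
  define V where "V c h = (v (x + h * c) (y + h * \<Delta>y) - 2 * v (x + h * c) y + v (x + h * c) (y - h * \<Delta>y)) / (h * \<Delta>y)\<^sup>2" for c h
  define M where "M w h = (w (x + h * \<Delta>x) (y + h * \<Delta>y) - w (x - h * \<Delta>x) (y + h * \<Delta>y)
              - w (x + h * \<Delta>x) (y - h * \<Delta>y) + w (x - h * \<Delta>x) (y - h * \<Delta>y)) / (4 * (h * \<Delta>x) * (h * \<Delta>y))"
    for w :: "real \<Rightarrow> real \<Rightarrow> real" and h
  define L where "L h = c1 * \<Delta>x * ((U \<Delta>y h + 2 * U 0 h + U (- \<Delta>y) h) / 4) + c2 * \<Delta>y * M u h +
      c1 * \<Delta>x * M v h + c2 * \<Delta>y * ((V \<Delta>x h + 2 * V 0 h + V (- \<Delta>x) h) / 4)" for h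
  have "(L \<longlongrightarrow>
      c1 * \<Delta>x * ((pd_x (pd_x u) x y + 2 * pd_x (pd_x u) x y + pd_x (pd_x u) x y) / 4) +
      c2 * \<Delta>y * pd_x (pd_y u) x y + c1 * \<Delta>x * pd_x (pd_y v) x y +
      c2 * \<Delta>y * ((pd_y (pd_y v) x y + 2 * pd_y (pd_y v) x y + pd_y (pd_y v) x y) / 4)) (at_right 0)"
    unfolding L_def U_def V_def M_def
    by (intro tendsto_intros second_difference_x_tendsto second_difference_y_tendsto
        mixed_difference_tendsto u v pos) auto
  moreover have "fd_refined \<Delta>x \<Delta>y (diffusion_formula \<Delta>x \<Delta>y c1 c2) u v x y h / h = L h" for h
    using pos
    unfolding fd_refined_def sum_moore diffusion_formula_def w_defs L_def U_def V_def M_def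
    by (simp add: add_divide_distrib diff_divide_distrib algebra_simps power2_eq_square)
  ultimately show ?thesis by simp
qed

lemma diffusion_formula_is_diffusion:
  assumes "\<Delta>x > 0" "\<Delta>y > 0"
  shows "diffusion \<Delta>x \<Delta>y (diffusion_formula \<Delta>x \<Delta>y c1 c2)"
proof (cases "c1 = 0 \<and> c2 = 0")
  case True
  then have "\<not> nonzero_formula (diffusion_formula \<Delta>x \<Delta>y c1 c2)"
    unfolding nonzero_formula_def fd_apply_def diffusion_formula_def by simp
  then show ?thesis unfolding diffusion_def by blast
next
  case False
  with assms have ne: "(c1 * \<Delta>x, c2 * \<Delta>y, 0, 0, c1 * \<Delta>x, c2 * \<Delta>y) \<noteq> (0, 0, 0, 0, 0, 0)"
    by auto
  show ?thesis
    unfolding diffusion_def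
    using diffusion_formula_tendsto[OF assms, of _ _ c1 c2]
    by - (rule disjI2, rule exI[of _ "c1 * \<Delta>x"], rule exI[of _ "c2 * \<Delta>y"], rule exI[of _ 0],
        rule exI[of _ 0], rule exI[of _ "c1 * \<Delta>x"], rule exI[of _ "c2 * \<Delta>y"],
        rule conjI[OF ne], simp)
qed

lemma diffusion_formula_nonzero:
  assumes "\<Delta>x > 0"
  shows "nonzero_formula (diffusion_formula \<Delta>x \<Delta>y 1 0)"
proof -
  have "(1, 1) \<in> moore" by (simp add: moore_def)
  moreover have "fst (diffusion_formula \<Delta>x \<Delta>y 1 0) 1 1 \<noteq> 0"
    using assms by (simp add: diffusion_formula_def w_defs)
  ultimately show ?thesis using zero_formula_iff by blast
qed

text \<open>
  The factor between the two symbols has poles exactly at the highest frequency, where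
  \<open>exp (\<i> * k * d) = -1\<close>. These wave numbers form an arithmetic progression, hence a countable set.
\<close>

lemma dense_open_nonresonant:
  assumes "d > 0"
  shows "open {k. exp (\<i> * complex_of_real (k * d)) \<noteq> -1}"
    and "closure {k. exp (\<i> * complex_of_real (k * d)) \<noteq> -1} = UNIV"
proof -
  let ?K = "{k. exp (\<i> * complex_of_real (k * d)) \<noteq> -1}"
  show "open ?K"
    by (intro open_Collect_neq continuous_intros)
  have "- ?K \<subseteq> range (\<lambda>n. (of_int (2 * n + 1) * pi) / d)"
  proof
    fix k assume "k \<in> - ?K"
    then have "exp (\<i> * complex_of_real (k * d)) = exp (\<i> * complex_of_real pi)"
      by (simp add: mult.commute)
    then obtain n :: int where "\<i> * complex_of_real (k * d) = \<i> * complex_of_real pi + of_int (2 * n) * pi * \<i>"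
      unfolding exp_eq by blast
    then have "k * d = pi + of_int (2 * n) * pi" by (simp add: complex_eq_iff)
    with assms show "k \<in> range (\<lambda>n. (of_int (2 * n + 1) * pi) / d)"
      by (intro image_eqI[of _ _ n]) (auto simp: field_simps)
  qed
  then have "countable (- ?K)" by (rule countable_subset) auto
  then have "interior (- ?K) = {}"
    using open_minus_countable[of "- ?K" "interior (- ?K)"] interior_subset by blast
  then show "closure ?K = UNIV" by (simp add: closure_interior)
qed

text \<open>
  With $t_x, t_y$ abbreviated to \<open>z\<close>, \<open>w\<close>, both symbols of the divergence contain
  \<open>(z + 1) * (w + 1) / (z * w)\<close>, and the remaining factors are \<open>(z - 1) * (w + 1) / (8 * \<Delta>x)\<close> for \<open>u\<close> and
  \<open>(z + 1) * (w - 1) / (8 * \<Delta>y)\<close> for \<open>v\<close>. The symbols of the diffusion have the same remaining factors, up to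
  constants, so the quotient is common to \<open>u\<close> and \<open>v\<close>.
\<close>

lemma diffusion_formula_consistent:
  assumes pos: "\<Delta>x > 0" "\<Delta>y > 0"
  shows "stationarity_consistent \<Delta>x \<Delta>y (diffusion_formula \<Delta>x \<Delta>y c1 c2) (divergence_formula \<Delta>x \<Delta>y)"
proof -
  define K where "K d = {k. exp (\<i> * complex_of_real (k * d)) \<noteq> -1}" for d
  \<comment> \<open>The summands are, up to constants, \<open>[[q]] / [q]\<close> in either direction:
    the pole at \<open>-1\<close> is the zero of \<open>[q]\<close> that
    \<open>[[q]]\<close> does not share.\<close>
  define R where "R z w = 2 * c1 * ((z - 1) / (z + 1)) + 2 * c2 * ((w - 1) / (w + 1))" for z w :: complex
  have factor: "stencil_symbol (fst (diffusion_formula \<Delta>x \<Delta>y c1 c2)) z w =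
        R z w * stencil_symbol (fst (divergence_formula \<Delta>x \<Delta>y)) z w \<and>
      stencil_symbol (snd (diffusion_formula \<Delta>x \<Delta>y c1 c2)) z w =
        R z w * stencil_symbol (snd (divergence_formula \<Delta>x \<Delta>y)) z w"
    if nz: "z \<noteq> 0" "w \<noteq> 0" "z \<noteq> -1" "w \<noteq> -1" for z w
  proof -
    have d: "stencil_symbol (fst (divergence_formula \<Delta>x \<Delta>y)) z w =
        (z + 1) * (w + 1) * ((z - 1) * (w + 1)) / (8 * \<Delta>x * z * w)"
      "stencil_symbol (snd (divergence_formula \<Delta>x \<Delta>y)) z w =
        (z + 1) * (w + 1) * ((z + 1) * (w - 1)) / (8 * \<Delta>y * z * w)"
      using nz pos unfolding stencil_symbol_expand divergence_formula_def w_defs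
      by (simp_all add: field_simps)
    have s: "stencil_symbol (fst (diffusion_formula \<Delta>x \<Delta>y c1 c2)) z w =
        (c1 * ((z - 1) * (w + 1)) + c2 * ((z + 1) * (w - 1))) * ((z - 1) * (w + 1)) / (4 * \<Delta>x * z * w)"
      "stencil_symbol (snd (diffusion_formula \<Delta>x \<Delta>y c1 c2)) z w =
        (c1 * ((z - 1) * (w + 1)) + c2 * ((z + 1) * (w - 1))) * ((z + 1) * (w - 1)) / (4 * \<Delta>y * z * w)"
      using nz pos unfolding stencil_symbol_expand diffusion_formula_def w_defs
      by (simp_all add: field_simps)
    have "z + 1 \<noteq> 0" "w + 1 \<noteq> 0" using nz by (auto simp: add_eq_0_iff2)
    then have cancel: "(z - 1) / (z + 1) * (z + 1) = z - 1" "(w - 1) / (w + 1) * (w + 1) = w - 1"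
      by simp_all
    have "R z w * ((z + 1) * (w + 1)) =
        2 * c1 * ((z - 1) / (z + 1) * (z + 1)) * (w + 1) + 2 * c2 * ((w - 1) / (w + 1) * (w + 1)) * (z + 1)"
      unfolding R_def by (simp only: algebra_simps)
    also have "\<dots> = 2 * (c1 * ((z - 1) * (w + 1)) + c2 * ((z + 1) * (w - 1)))"
      unfolding cancel by (simp add: algebra_simps)
    finally have "R z w * ((z + 1) * (w + 1)) =
        2 * (c1 * ((z - 1) * (w + 1)) + c2 * ((z + 1) * (w - 1)))" .
    then have R: "c1 * ((z - 1) * (w + 1)) + c2 * ((z + 1) * (w - 1)) = R z w * ((z + 1) * (w + 1)) / 2"
      by simp
    show ?thesis unfolding d s R by (simp add: mult.assoc)
  qed
  show ?thesis
    unfolding stationarity_consistent_def Let_def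
  proof (intro exI[of _ R] exI[of _ "K \<Delta>x \<times> K \<Delta>y"] conjI)
    show "open (K \<Delta>x \<times> K \<Delta>y)"
      unfolding K_def by (intro open_Times dense_open_nonresonant pos)
    show "closure (K \<Delta>x \<times> K \<Delta>y) = UNIV"
      unfolding K_def closure_Times dense_open_nonresonant(2)[OF pos(1)]
        dense_open_nonresonant(2)[OF pos(2)] by simp
    show "\<forall>(kx, ky)\<in>K \<Delta>x \<times> K \<Delta>y. \<forall>uh vh.
       fourier_symbol (diffusion_formula \<Delta>x \<Delta>y c1 c2) (exp (\<i> * complex_of_real (kx * \<Delta>x)))
         (exp (\<i> * complex_of_real (ky * \<Delta>y))) uh vh =
       R (exp (\<i> * complex_of_real (kx * \<Delta>x))) (exp (\<i> * complex_of_real (ky * \<Delta>y))) *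
       fourier_symbol (divergence_formula \<Delta>x \<Delta>y) (exp (\<i> * complex_of_real (kx * \<Delta>x)))
         (exp (\<i> * complex_of_real (ky * \<Delta>y))) uh vh"
      unfolding K_def fourier_symbol_stencil
      using factor by (auto simp: algebra_simps)
  qed
qed

section \<open>Uniqueness of the divergence\<close>

text \<open>
  Tested on the fields \<open>u = x\<close>, \<open>v = 0\<close>, for which the refined formula is independent of \<open>h\<close>.
\<close>

lemma divergence_first_moment:
  assumes "divergence_discretization \<Delta>x \<Delta>y A"
  shows "\<Delta>x * (\<Sum>(s, r)\<in>moore. of_int s * fst A s r) = 1"
proof -
  have "((\<lambda>h. fd_refined \<Delta>x \<Delta>y A (\<lambda>x y. 0 + 1 * x + 0 * y) (\<lambda>x y. 0 + 0 * x + 0 * y) 0 0 h) \<longlongrightarrow>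
      pd_x (\<lambda>x y. 0 + 1 * x + 0 * y) 0 0 + pd_y (\<lambda>x y. 0 + 0 * x + 0 * y) 0 0) (at_right 0)"
    using assms smooth_affine unfolding divergence_discretization_def by blast
  then have "((\<lambda>h. fd_refined \<Delta>x \<Delta>y A (\<lambda>x y. x) (\<lambda>x y. 0) 0 0 h) \<longlongrightarrow> 1) (at_right 0)"
    unfolding pd_affine by simp
  moreover have "\<forall>\<^sub>F h in at_right 0. fd_refined \<Delta>x \<Delta>y A (\<lambda>x y. x) (\<lambda>x y. 0) 0 0 h =
      \<Delta>x * (\<Sum>(s, r)\<in>moore. of_int s * fst A s r)"
    using eventually_at_right_less[of "0::real"]
    by eventually_elim (simp add: fd_refined_def sum_moore field_simps)
  ultimately have "((\<lambda>h::real. \<Delta>x * (\<Sum>(s, r)\<in>moore. of_int s * fst A s r)) \<longlongrightarrow> 1) (at_right 0)"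
    by (rule Lim_transform_eventually)
  then show ?thesis by (simp add: tendsto_const_iff)
qed

text \<open>
  For \<open>u = x\<close>, \<open>v = 0\<close> the quotient in the definition of a diffusion is the moment, up to the factor
  \<open>\<Delta>x\<close>, divided by \<open>h\<close>; it can only tend to the vanishing second derivatives if the moment is zero.
\<close>

lemma diffusion_first_moment:
  assumes "diffusion \<Delta>x \<Delta>y B" "nonzero_formula B" "\<Delta>x \<noteq> 0"
  shows "(\<Sum>(s, r)\<in>moore. of_int s * fst B s r) = 0"
proof -
  define m where "m = \<Delta>x * (\<Sum>(s, r)\<in>moore. of_int s * fst B s r)"
  obtain a1 a2 a3 b1 b2 b3 where *: "\<And>u v x y. smooth u \<Longrightarrow> smooth v \<Longrightarrow>
      ((\<lambda>h. fd_refined \<Delta>x \<Delta>y B u v x y h / h) \<longlongrightarrow>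
         a1 * pd_x (pd_x u) x y + a2 * pd_x (pd_y u) x y + a3 * pd_y (pd_y u) x y +
         b1 * pd_x (pd_x v) x y + b2 * pd_x (pd_y v) x y + b3 * pd_y (pd_y v) x y) (at_right 0)"
    using assms(1,2) unfolding diffusion_def by blast
  have const: "pd_x (\<lambda>x y. c) = (\<lambda>x y. 0)" "pd_y (\<lambda>x y. c) = (\<lambda>x y. 0)" for c
    by (simp_all add: pd_x_def pd_y_def)
  have "((\<lambda>h. fd_refined \<Delta>x \<Delta>y B (\<lambda>x y. x) (\<lambda>x y. 0) 0 0 h / h) \<longlongrightarrow> 0) (at_right 0)"
    using *[OF smooth_affine[of 0 1 0] smooth_affine[of 0 0 0], of 0 0]
    unfolding pd_affine by (simp add: const)
  moreover have "\<forall>\<^sub>F h in at_right 0. fd_refined \<Delta>x \<Delta>y B (\<lambda>x y. x) (\<lambda>x y. 0) 0 0 h / h = m / h"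
    using eventually_at_right_less[of "0::real"]
    by eventually_elim (simp add: fd_refined_def sum_moore m_def field_simps)
  ultimately have "((\<lambda>h. m / h) \<longlongrightarrow> 0) (at_right 0)"
    by (rule Lim_transform_eventually)
  then have "((\<lambda>h. m / h * h) \<longlongrightarrow> 0 * 0) (at_right 0)"
    by (intro tendsto_intros)
  moreover have "\<forall>\<^sub>F h in at_right 0. m / h * h = m"
    using eventually_at_right_less[of "0::real"] by eventually_elim simp
  ultimately have "((\<lambda>h::real. m) \<longlongrightarrow> 0 * 0) (at_right 0)"
    by (rule Lim_transform_eventually)
  then show ?thesis using \<open>\<Delta>x \<noteq> 0\<close> by (simp add: tendsto_const_iff m_def)
qed

text \<open>
  Symmetry leaves two free weights, \<open>fst A 1 0\<close> and \<open>fst A 1 1\<close>.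
\<close>

lemma symmetric_formula_coeffs:
  assumes "symmetric_formula \<Delta>x \<Delta>y A" "\<Delta>y \<noteq> 0" "(s, r) \<in> moore"
  shows "fst A s r = of_int s * fst A 1 (\<bar>r\<bar>)"
    and "snd A s r = \<Delta>x / \<Delta>y * (of_int r * fst A 1 (\<bar>s\<bar>))"
proof -
  have sym: "fst A (- s) r = - fst A s r" "fst A s (- r) = fst A s r"
      "\<Delta>x * fst A s r = \<Delta>y * snd A r s"
    if "(s, r) \<in> moore" for s r
    using assms(1) that unfolding symmetric_formula_def by auto
  have fst_eq: "fst A s r = of_int s * fst A 1 (\<bar>r\<bar>)" if "(s, r) \<in> moore" for s r
    using moore_cases[OF that] sym(1)[of 1 r] sym(1)[of 0 r] sym(2)[of s 1] sym(2)[of 1 1]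
    by (auto simp: moore_def)
  from fst_eq assms(3) show "fst A s r = of_int s * fst A 1 (\<bar>r\<bar>)" .
  have "(r, s) \<in> moore" using assms(3) unfolding moore_def by auto
  then show "snd A s r = \<Delta>x / \<Delta>y * (of_int r * fst A 1 (\<bar>s\<bar>))"
    using sym(3)[of r s] fst_eq[of r s] \<open>\<Delta>y \<noteq> 0\<close> by (simp add: field_simps)
qed

lemma symmetric_formula_symbol:
  assumes "symmetric_formula \<Delta>x \<Delta>y A" "\<Delta>y \<noteq> 0"
  defines "p \<equiv> fst A 1 1" and "q \<equiv> fst A 1 0"
  shows "stencil_symbol (fst A) z w = (z - 1 / z) * (q + p * (w + 1 / w))"
    and "stencil_symbol (snd A) z w = of_real (\<Delta>x / \<Delta>y) * (w - 1 / w) * (q + p * (z + 1 / z))"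
proof -
  note c = symmetric_formula_coeffs[OF assms(1,2)]
  have *: "stencil_symbol (fst A) z w = stencil_symbol (\<lambda>s r. of_int s * fst A 1 (\<bar>r\<bar>)) z w"
    "stencil_symbol (snd A) z w = stencil_symbol (\<lambda>s r. \<Delta>x / \<Delta>y * (of_int r * fst A 1 (\<bar>s\<bar>))) z w"
    unfolding stencil_symbol_def by (intro sum.cong refl, use c in auto)+
  show "stencil_symbol (fst A) z w = (z - 1 / z) * (q + p * (w + 1 / w))"
    "stencil_symbol (snd A) z w = of_real (\<Delta>x / \<Delta>y) * (w - 1 / w) * (q + p * (z + 1 / z))"
    unfolding * unfolding stencil_symbol_expand p_def q_def
    by (simp_all add: add_divide_distrib diff_divide_distrib algebra_simps)
qed

text \<open>
  Otherwise both symbols of \<open>B\<close> contain the odd factor of the corresponding symbol of \<open>A\<close>. The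
  quotients depend on one variable each, and a separation of variables shows that they are
  proportional to those of \<open>A\<close>: the formula \<open>B\<close> is a multiple of \<open>A\<close>. A diffusion has no first moment,
  whereas that of \<open>A\<close> is proportional to \<open>fst A 1 0 + 2 * fst A 1 1\<close> and does not vanish, so \<open>B\<close> would be
  zero.
\<close>

lemma diffusion_forces_weights:
  assumes pos: "\<Delta>x > 0" "\<Delta>y > 0" and sym: "symmetric_formula \<Delta>x \<Delta>y A"
    and diff: "diffusion \<Delta>x \<Delta>y B" "nonzero_formula B"
    and sc: "stationarity_consistent \<Delta>x \<Delta>y B A"
    and cons: "fst A 1 0 \<noteq> - 2 * fst A 1 1"
  shows "fst A 1 0 = 2 * fst A 1 1"
proof (rule ccontr)
  define p q \<kappa> where "p = fst A 1 1" and "q = fst A 1 0" and "\<kappa> = \<Delta>x / \<Delta>y"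
  have \<kappa>: "\<kappa> \<noteq> 0" using pos by (simp add: \<kappa>_def)
  assume "fst A 1 0 \<noteq> 2 * fst A 1 1"
  then have pq: "q \<noteq> 2 * p" "q \<noteq> - 2 * p" using cons by (auto simp: p_def q_def)
  note symbols = symmetric_formula_symbol[OF sym less_imp_neq[OF pos(2), symmetric],
      folded p_def q_def \<kappa>_def]
  have cross: "stencil_symbol (fst B) z w * (of_real \<kappa> * (w - 1 / w) * (q + p * (z + 1 / z))) =
      stencil_symbol (snd B) z w * ((z - 1 / z) * (q + p * (w + 1 / w)))"
    if "norm z = 1" "norm w = 1" for z w :: complex
    using stationarity_consistent_cross[OF sc pos that] unfolding symbols .
  have "fst B 0 r = 0 \<and> fst B (-1) r = - fst B 1 r" if "r \<in> {-1, 0, 1}" for r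
    by (rule cross_identity_forces_odd[where b = "snd B" and \<mu> = 1, OF _ \<kappa> pq that])
      (simp only: cross of_real_1 mult_1_left)
  then have u: "fst B 0 r = 0" "fst B (-1) r = - fst B 1 r" if "r \<in> {-1, 0, 1}" for r
    using that by blast+
  have "snd B s 0 = 0 \<and> snd B s (-1) = - snd B s 1" if "s \<in> {-1, 0, 1}" for s
    by (rule cross_identity_forces_odd[where a = "\<lambda>s r. snd B r s" and b = "\<lambda>s r. fst B r s"
          and \<kappa> = 1 and \<mu> = \<kappa>, OF _ _ pq that])
      (simp_all only: stencil_symbol_transpose[of "fst B"] stencil_symbol_transpose[of "snd B"]
        cross of_real_1 mult_1_left one_neq_zero not_False_eq_True)
  then have v: "snd B s 0 = 0" "snd B s (-1) = - snd B s 1" if "s \<in> {-1, 0, 1}" for s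
    using that by blast+
  define a where "a = (\<lambda>r. complex_of_real (fst B 1 r))"
  define b where "b = (\<lambda>s. complex_of_real (snd B s 1))"
  have B_symbols: "stencil_symbol (fst B) z w = (z - 1 / z) * (a (-1) / w + a 0 + a 1 * w)"
    "stencil_symbol (snd B) z w = (w - 1 / w) * (b (-1) / z + b 0 + b 1 * z)" for z w
    unfolding stencil_symbol_expand a_def b_def
    by (simp_all add: u v add_divide_distrib diff_divide_distrib algebra_simps)
  \<comment> \<open>After division by the odd factors, comparing coefficients in \<open>w\<close> for fixed \<open>z\<close> shows that
    \<open>B\<close> can only be a multiple of \<open>A\<close>.\<close>
  have separated: "a (-1) * X = p * Y \<and> a 0 * X = q * Y \<and> a 1 * X = p * Y"
    if z: "norm z = 1" "z \<noteq> 1" "z \<noteq> -1"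
      and X: "X = \<kappa> * (q + p * (z + 1 / z))" and Y: "Y = b (-1) / z + b 0 + b 1 * z"
    for z X Y :: complex
  proof -
    have "(a (-1) * X - p * Y) / w + (a 0 * X - q * Y) + (a 1 * X - p * Y) * w = 0"
      if w: "norm w = 1" "w \<noteq> 1" "w \<noteq> -1" for w
    proof -
      have cancel: "t * u * (S * (k * V) - Y * P) = 0" if "t * S * (k * u * V) = u * Y * (t * P)"
        for t u S k V P :: complex
        using that by (simp add: algebra_simps)
      have "(z - 1 / z) * (w - 1 / w) *
          ((a (-1) / w + a 0 + a 1 * w) * X - Y * (q + p * (w + 1 / w))) = 0"
        unfolding X by (rule cancel) (use cross[OF z(1) w(1)] in \<open>simp only: B_symbols Y\<close>)
      then have "(a (-1) / w + a 0 + a 1 * w) * X - Y * (q + p * (w + 1 / w)) = 0"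
        using unit_minus_inverse_nonzero[OF z] unit_minus_inverse_nonzero[OF w] by simp
      then show ?thesis by (simp add: add_divide_distrib diff_divide_distrib algebra_simps)
    qed
    from laurent_zero_on_circle[OF this] show ?thesis by simp
  qed
  have "fst B 1 (-1) + fst B 1 0 + fst B 1 1 = 0"
    using diffusion_first_moment[OF diff] pos by (simp add: sum_moore u)
  then have a_sum: "a (-1) + a 0 + a 1 = 0"
    unfolding a_def by (metis of_real_add of_real_0)
  \<comment> \<open>Evaluating the polynomial identity in \<open>w\<close> at \<open>w = 1\<close>, where the first moment appears.\<close>
  have b_symbol: "b (-1) / z + b 0 + b 1 * z = 0"
    if z: "norm z = 1" "z \<noteq> 1" "z \<noteq> -1" for z
  proof -
    define X where "X = \<kappa> * (q + p * (z + 1 / z))"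
    define Y where "Y = b (-1) / z + b 0 + b 1 * z"
    have "(a (-1) + a 0 + a 1) * X = (q + 2 * p) * Y"
      using separated[OF z X_def Y_def] by (simp add: algebra_simps)
    then have "of_real (q + 2 * p) * Y = 0" using a_sum by simp
    then show ?thesis using pq(2) unfolding mult_eq_0_iff of_real_eq_0_iff Y_def by auto
  qed
  then have b0: "b (-1) = 0" "b 0 = 0" "b 1 = 0"
    using laurent_zero_on_circle[of "b (-1)" "b 0" "b 1"] by auto
  have "p \<noteq> 0 \<or> q \<noteq> 0" using pq by auto
  have a0: "a r = 0" if "r \<in> {-1, 0, 1}" for r
  proof -
    have "(a r * \<kappa> * p) / z + a r * \<kappa> * q + (a r * \<kappa> * p) * z = 0"
      if z: "norm z = 1" "z \<noteq> 1" "z \<noteq> -1" for z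
      using separated[OF z refl refl] b0 \<open>r \<in> {-1, 0, 1}\<close>
      by (auto simp: add_divide_distrib algebra_simps)
    from laurent_zero_on_circle[OF this] show ?thesis
      using \<kappa> \<open>p \<noteq> 0 \<or> q \<noteq> 0\<close> by auto
  qed
  have "fst B s r = 0 \<and> snd B s r = 0" if "(s, r) \<in> moore" for s r
    using moore_cases[OF that] a0[of r] b0 u[of r] v[of s] unfolding a_def b_def by auto
  with diff(2) show False using zero_formula_iff by blast
qed

theorem theorem4p4:
  fixes \<Delta>x \<Delta>y :: real
  assumes "\<Delta>x > 0" and "\<Delta>y > 0"
  shows
    "(\<exists>A. fd_apply A = the_divergence \<Delta>x \<Delta>y \<and>
          symmetric_formula \<Delta>x \<Delta>y A \<and> divergence_discretization \<Delta>x \<Delta>y A \<and>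
          allows_nonzero_diffusion \<Delta>x \<Delta>y A) \<and>
     (\<forall>A. symmetric_formula \<Delta>x \<Delta>y A \<longrightarrow> divergence_discretization \<Delta>x \<Delta>y A \<longrightarrow>
          allows_nonzero_diffusion \<Delta>x \<Delta>y A \<longrightarrow> fd_apply A = the_divergence \<Delta>x \<Delta>y) \<and>
     (\<forall>A c1 c2. fd_apply A = the_divergence \<Delta>x \<Delta>y \<longrightarrow>
          (\<exists>B. fd_apply B = the_diffusion \<Delta>x \<Delta>y c1 c2 \<and>
               diffusion \<Delta>x \<Delta>y B \<and> stationarity_consistent \<Delta>x \<Delta>y B A))"
proof (intro conjI allI impI)
  let ?A = "divergence_formula \<Delta>x \<Delta>y" and ?B = "diffusion_formula \<Delta>x \<Delta>y"
  have "symmetric_formula \<Delta>x \<Delta>y ?A"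
    using assms unfolding symmetric_formula_def divergence_formula_def w_defs by auto
  moreover have "allows_nonzero_diffusion \<Delta>x \<Delta>y ?A"
    unfolding allows_nonzero_diffusion_def
    using diffusion_formula_is_diffusion[OF assms] diffusion_formula_nonzero[OF assms(1)]
      diffusion_formula_consistent[OF assms] by blast
  ultimately show "\<exists>A. fd_apply A = the_divergence \<Delta>x \<Delta>y \<and>
      symmetric_formula \<Delta>x \<Delta>y A \<and> divergence_discretization \<Delta>x \<Delta>y A \<and>
      allows_nonzero_diffusion \<Delta>x \<Delta>y A"
    using fd_apply_divergence_formula divergence_formula_discretizes[OF assms] by blast
  fix A
  show "\<exists>B. fd_apply B = the_diffusion \<Delta>x \<Delta>y c1 c2 \<and>
      diffusion \<Delta>x \<Delta>y B \<and> stationarity_consistent \<Delta>x \<Delta>y B A"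
    if "fd_apply A = the_divergence \<Delta>x \<Delta>y" for c1 c2
    using that fd_apply_diffusion_formula diffusion_formula_is_diffusion[OF assms]
      diffusion_formula_consistent[OF assms] stationarity_consistent_cong fd_apply_divergence_formula
    by metis
  assume sym: "symmetric_formula \<Delta>x \<Delta>y A" and div: "divergence_discretization \<Delta>x \<Delta>y A"
    and "allows_nonzero_diffusion \<Delta>x \<Delta>y A"
  then obtain B where B: "diffusion \<Delta>x \<Delta>y B" "nonzero_formula B" "stationarity_consistent \<Delta>x \<Delta>y B A"
    unfolding allows_nonzero_diffusion_def by blast
  note coeffs = symmetric_formula_coeffs[OF sym less_imp_neq[OF assms(2), symmetric]]
  \<comment> \<open>Consistency normalizes the two remaining weights, and thereby excludes \<open>q = - 2 * p\<close>.\<close>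
  have norm: "2 * \<Delta>x * (2 * fst A 1 1 + fst A 1 0) = 1"
  proof -
    have "(\<Sum>(s, r)\<in>moore. of_int s * fst A s r) =
        (\<Sum>(s, r)\<in>moore. of_int s * (of_int s * fst A 1 (\<bar>r\<bar>)))"
      by (intro sum.cong refl) (use coeffs in auto)
    with divergence_first_moment[OF div] show ?thesis by (simp add: sum_moore algebra_simps)
  qed
  then have "fst A 1 0 \<noteq> - 2 * fst A 1 1" by auto
  from diffusion_forces_weights[OF assms sym B this] norm
  have pq: "fst A 1 1 = 1 / (8 * \<Delta>x)" "fst A 1 0 = 2 / (8 * \<Delta>x)"
    using assms by (auto simp: field_simps)
  have "fst A s r = fst ?A s r \<and> snd A s r = snd ?A s r" if "(s, r) \<in> moore" for s r
    using moore_cases[OF that] coeffs[OF that] pq assms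
    unfolding divergence_formula_def w_defs by auto
  then have "fd_apply A = fd_apply ?A" unfolding fd_apply_eq_iff by auto
  then show "fd_apply A = the_divergence \<Delta>x \<Delta>y" unfolding fd_apply_divergence_formula .
qed

end
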